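(* Let $p,q$ be two coprime rational integers with $q\ge 2$ and $p\ne\pm1$, and let $b\in\{0,1,\dots,q-1\}$. Then there is a constant $C$ (independent of $N$), which can be effectively computed, such that for every positive integer $N$, $$\mathcal{M}_b(p,q,N)\le C\,N^{\log(q-1)/\log(q)}.$$
   Context: For $\gamma\in\mathbb{Z}$, the $q$-adic expansion of $\gamma$ with respect to the digit set $\{0,1,\dots,q-1\}$ is the unique sequence $(a_i)_{i\ge0}$ with $a_i\in\{0,1,\dots,q-1\}$ such that $\gamma-(a_0+a_1q+\cdots+a_iq^i)\in q^{i+1}\mathbb{Z}$ for every $i\ge0$. It is always an infinite sequence; for a nonnegative integer it is the usual base $q$ expansion followed by infinitely many zeros. One writes $(\gamma)_{q,j}:=a_j$, and $$\mathcal{M}_b(p,q,N):=\#\{1\le n\le N:\ (p^n)_{q,j}\ne b\text{ for all } j\ge0\}.$$ *)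

theory Defs
  imports Complex_Main "HOL-Library.Nat_Bijection"
begin

definition is_qadic_expansion :: "int \<Rightarrow> int \<Rightarrow> (nat \<Rightarrow> int) \<Rightarrow> bool" where
  "is_qadic_expansion q \<gamma> a \<longleftrightarrow>
     (\<forall>i. a i \<in> {0..<q}) \<and> (\<forall>i. q ^ (i + 1) dvd \<gamma> - (\<Sum>k\<le>i. a k * q ^ k))"

definition qadic_digit :: "int \<Rightarrow> int \<Rightarrow> nat \<Rightarrow> int" where
  "qadic_digit q \<gamma> = (THE a. is_qadic_expansion q \<gamma> a)"

lemma is_qadic_expansion_div_mod:
  assumes "q \<ge> 2"
  shows "is_qadic_expansion q \<gamma> (\<lambda>j. \<gamma> div q ^ j mod q)"
proof -
  have *: "\<gamma> - (\<Sum>k\<le>i. (\<gamma> div q ^ k mod q) * q ^ k) = q ^ Suc i * (\<gamma> div q ^ Suc i)" for i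
  proof (induction i)
    case 0
    show ?case by (simp add: minus_mod_eq_mult_div)
  next
    case (Suc i)
    let ?d = "\<gamma> div q ^ Suc i"
    have "\<gamma> div q ^ Suc (Suc i) = ?d div q"
      using assms by (simp add: zdiv_zmult2_eq mult.commute[of q])
    moreover have "?d = q * (?d div q) + ?d mod q" by simp
    ultimately have "q ^ Suc i * ?d - ?d mod q * q ^ Suc i
        = q ^ Suc (Suc i) * (\<gamma> div q ^ Suc (Suc i))"
      by (metis (no_types, lifting) minus_mod_eq_mult_div mult.assoc mult.commute
          power_Suc right_diff_distrib)
    with Suc show ?case by (simp add: algebra_simps)
  qed
  show ?thesis
    unfolding is_qadic_expansion_def using assms * by simp
qed

lemma is_qadic_expansion_unique:
  assumes "q \<ge> 2" "is_qadic_expansion q \<gamma> a" "is_qadic_expansion q \<gamma> a'"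
  shows "a = a'"
proof
  fix j
  show "a j = a' j"
  proof (induction j rule: less_induct)
    case (less j)
    have "(\<Sum>k\<le>j. a k * q ^ k) - (\<Sum>k\<le>j. a' k * q ^ k) = (a j - a' j) * q ^ j"
      using less by (simp add: lessThan_Suc_atMost[symmetric] algebra_simps)
    moreover have "q ^ (j + 1) dvd
        (\<gamma> - (\<Sum>k\<le>j. a' k * q ^ k)) - (\<gamma> - (\<Sum>k\<le>j. a k * q ^ k))"
      using assms(2,3) unfolding is_qadic_expansion_def by (blast intro: dvd_diff)
    ultimately have "q * q ^ j dvd (a j - a' j) * q ^ j" by simp
    then have "q dvd a j - a' j" using assms(1) by simp
    moreover have "a j \<in> {0..<q}" "a' j \<in> {0..<q}"
      using assms(2,3) unfolding is_qadic_expansion_def by blast+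
    ultimately show ?case
      by (metis atLeastLessThan_iff mod_eq_dvd_iff mod_pos_pos_trivial)
  qed
qed

lemma qadic_digit_eq:
  assumes "q \<ge> 2"
  shows "qadic_digit q \<gamma> j = \<gamma> div q ^ j mod q"
proof -
  have "qadic_digit q \<gamma> = (\<lambda>j. \<gamma> div q ^ j mod q)"
    unfolding qadic_digit_def
    using is_qadic_expansion_div_mod[OF assms] is_qadic_expansion_unique[OF assms]
    by (intro the_equality) blast+
  then show ?thesis by simp
qed

definition avoid_count :: "int \<Rightarrow> int \<Rightarrow> int \<Rightarrow> nat \<Rightarrow> nat" where
  "avoid_count b p q N = card {n. 1 \<le> n \<and> n \<le> N \<and> (\<forall>j. qadic_digit q (p ^ n) j \<noteq> b)}"

text \<open>Total recursive (computable) functions of \<open>k\<close> natural number arguments. A function of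
  \<open>k\<close> arguments is represented by its values on lists of length \<open>k\<close>; by rule \<open>ext\<close> its values on
  other lists are irrelevant. Minimization is restricted to functions for which the search
  always succeeds, so the class contains total functions only.\<close>

inductive total_recursive :: "nat \<Rightarrow> (nat list \<Rightarrow> nat) \<Rightarrow> bool" where
  zero: "total_recursive k (\<lambda>xs. 0)"
| succ: "total_recursive 1 (\<lambda>xs. Suc (xs ! 0))"
| proj: "i < k \<Longrightarrow> total_recursive k (\<lambda>xs. xs ! i)"
| comp: "total_recursive (length gs) f \<Longrightarrow> (\<forall>g \<in> set gs. total_recursive k g) \<Longrightarrow>
    total_recursive k (\<lambda>xs. f (map (\<lambda>g. g xs) gs))"
| prim_rec: "total_recursive k f \<Longrightarrow> total_recursive (k + 2) g \<Longrightarrow>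
    total_recursive (k + 1)
      (\<lambda>xs. rec_nat (f (tl xs)) (\<lambda>n r. g (n # r # tl xs)) (hd xs))"
| minimize: "total_recursive (k + 1) f \<Longrightarrow> (\<forall>xs. length xs = k \<longrightarrow> (\<exists>y. f (y # xs) = 0)) \<Longrightarrow>
    total_recursive k (\<lambda>xs. LEAST y. f (y # xs) = 0)"
| ext: "total_recursive k f \<Longrightarrow> (\<forall>xs. length xs = k \<longrightarrow> f xs = g xs) \<Longrightarrow> total_recursive k g"

text \<open>Computability of a function of three integers, via the standard coding of \<open>int\<close> in \<open>nat\<close>.\<close>

definition computable_int3 :: "(int \<Rightarrow> int \<Rightarrow> int \<Rightarrow> nat) \<Rightarrow> bool" where
  "computable_int3 C \<longleftrightarrow>
     (\<exists>f. total_recursive 3 f \<and>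
        (\<forall>x y z. C x y z = f [int_encode x, int_encode y, int_encode z]))"

end

theory Submission
  imports Defs "HOL-Library.FuncSet" "HOL-Number_Theory.Number_Theory"
begin

text \<open>
  The powers of \<open>p\<close> are spread out \<open>q\<close>-adically: there is a constant \<open>D\<close> such that \<open>p ^ m\<close> can be
  congruent to \<open>1\<close> modulo \<open>q ^ K\<close> only if \<open>q ^ K \<le> D * m\<close>, so the order of \<open>p\<close> modulo \<open>q ^ K\<close>
  is at least \<open>q ^ K / D\<close>. This comes from lifting the exponent. Let \<open>T\<close> be Euler's totient of
  \<open>q\<^sup>2\<close>. The number \<open>x = p ^ T\<close> is \<open>1\<close> modulo \<open>q\<^sup>2\<close>, and for such \<open>x\<close> the numbers \<open>x ^ m - 1\<close> and
  \<open>(x - 1) * m\<close> have the same valuation at every prime divisor of \<open>q\<close>. Hence \<open>q ^ K\<close> divides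
  \<open>(x - 1) * m\<close>, which is nonzero since \<open>\<bar>p\<bar> \<ge> 2\<close>, and
  \<open>D = \<bar>p ^ T - 1\<bar>\<close> works. Lemmas \<open>power_dvd_times_exponent\<close> and \<open>power_le_exponent\<close> carry
  this part.

  Given \<open>N\<close>, choose \<open>K\<close> with \<open>D * N \<le> q ^ K \<le> q * D * N\<close>. The powers \<open>p ^ n\<close> with \<open>1 \<le> n \<le> N\<close> are
  then pairwise incongruent modulo \<open>q ^ K\<close>, so they are told apart by their first \<open>K\<close> digits.
  If all these digits avoid \<open>b\<close>, there are only \<open>(q - 1) ^ K\<close> possibilities for them. With
  \<open>\<theta> = ln (q - 1) / ln q \<in> [0, 1]\<close> this number equals
  \<open>(q ^ K) powr \<theta> \<le> (q * D * N) powr \<theta> \<le> q * D * N powr \<theta>\<close>.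

  For effectivity it remains to bound \<open>q * D\<close> by a computable function of \<open>p\<close> and \<open>q\<close>. The absolute
  value of an integer is at most its code, so \<open>Q * P ^ (Q * Q + 1)\<close> will do, where \<open>P\<close> and \<open>Q\<close> are
  the codes of \<open>p\<close> and \<open>q\<close>; this function is primitive recursive.
\<close>

section \<open>Lifting the exponent modulo powers of a composite base\<close>

lemma geometric_sum_cong:
  fixes x c :: int
  assumes "c dvd x - 1"
  shows "\<exists>t. (\<Sum>i<d. x ^ i) = int d + c * t"
proof -
  have "c dvd x ^ i - 1" for i
    using assms by (metis dvd_mult2 power_diff_1_eq)
  then have "c dvd (\<Sum>i<d. x ^ i - 1)" by (intro dvd_sum) auto
  then have "c dvd (\<Sum>i<d. x ^ i) - int d" by (simp add: sum_subtractf)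
  then show ?thesis by (metis add.commute diff_add_cancel dvdE)
qed

text \<open>
  Working with the common divisor \<open>d\<close> of \<open>m\<close> and \<open>q\<close> instead of single primes avoids factoring \<open>q\<close>.
  The quotient \<open>(x ^ d - 1) / (x - 1)\<close> is a geometric sum, congruent to \<open>d\<close> modulo \<open>q\<^sup>2\<close>. As \<open>d\<close>
  divides \<open>q\<close>, this sum is \<open>d\<close> times a number congruent to \<open>1\<close> modulo \<open>q\<close>, hence \<open>d\<close> times a
  number coprime to \<open>q\<close>. So passing from \<open>x\<close> to \<open>x ^ d\<close> costs exactly the factor \<open>d\<close>, and the
  exponent drops to \<open>m div d\<close>.
\<close>

lemma power_dvd_times_exponent:
  fixes x q :: int
  assumes "q ^ 2 dvd x - 1" "m \<ge> 1" "q ^ K dvd x ^ m - 1"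
  shows "q ^ K dvd (x - 1) * int m"
  using assms
proof (induction m arbitrary: x rule: less_induct)
  case (less m)
  define d where "d = nat (gcd (int m) q)"
  have d: "int d = gcd (int m) q" by (simp add: d_def)
  have "d dvd m" using d by (metis gcd_dvd1 int_dvd_int_iff)
  then obtain m' where m': "m = d * m'" by blast
  obtain r where r: "q = int d * r" using d by (metis dvdE gcd_dvd2)
  show ?case
  proof (cases "d = 1")
    case True
    \<comment> \<open>Now the whole geometric sum is coprime to \<open>q\<close> and can be cancelled, without descent.\<close>
    obtain t where t: "(\<Sum>i<m. x ^ i) = int m + q ^ 2 * t"
      using geometric_sum_cong less.prems(1) by blast
    have "coprime (int m) q" using True d by (simp add: coprime_iff_gcd_eq_1)
    then have "coprime (int m + q * (q * t)) q"
      by (metis coprime_iff_gcd_eq_1 gcd.commute gcd_add_mult mult.commute add.commute)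
    then have "coprime (q ^ K) (\<Sum>i<m. x ^ i)"
      by (simp add: t power2_eq_square mult.assoc coprime_commute)
    moreover have "q ^ K dvd (x - 1) * (\<Sum>i<m. x ^ i)"
      using less.prems(3) by (simp add: power_diff_1_eq)
    ultimately have "q ^ K dvd x - 1" by (simp add: coprime_dvd_mult_left_iff)
    then show ?thesis by simp
  next
    case False
    have "d \<noteq> 0" "m' \<ge> 1" using less.prems(2) m' by (auto intro: Suc_leI gr0I)
    with False have "m' < m" using m' by auto
    obtain t where t: "(\<Sum>i<d. x ^ i) = int d + q ^ 2 * t"
      using geometric_sum_cong less.prems(1) by blast
    define w where "w = 1 + q * (r * t)"
    have sum: "(\<Sum>i<d. x ^ i) = int d * w"
    proof -
      have "q ^ 2 * t = int d * (q * (r * t))"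
        by (subst power2_eq_square, subst (1) r) (simp add: mult_ac)
      then show ?thesis by (simp add: t w_def distrib_left)
    qed
    have "coprime w q"
      unfolding w_def
      by (metis coprime_iff_gcd_eq_1 gcd.commute gcd_add_mult mult.commute add.commute gcd_1_int coprime_1_left)
    then have "coprime (q ^ K) w" by (simp add: coprime_commute)
    have factor: "x ^ d - 1 = (x - 1) * (int d * w)"
      by (simp add: power_diff_1_eq sum)
    have "q ^ 2 dvd x ^ d - 1" using less.prems(1) by (simp add: factor)
    moreover have "q ^ K dvd (x ^ d) ^ m' - 1"
      using less.prems(3) by (simp add: m' power_mult)
    ultimately have "q ^ K dvd (x ^ d - 1) * int m'"
      using less.IH \<open>m' < m\<close> \<open>m' \<ge> 1\<close> by blast
    then have "q ^ K dvd ((x - 1) * int m) * w"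
      by (simp add: factor m' mult_ac)
    with \<open>coprime (q ^ K) w\<close> show ?thesis by (simp add: coprime_dvd_mult_left_iff)
  qed
qed

lemma euler_theorem_int:
  fixes p n :: int
  assumes "coprime p n" "n > 0"
  shows "n dvd p ^ totient (nat n) - 1"
proof -
  define a where "a = nat (p mod n)"
  have a: "int a = p mod n" using assms by (simp add: a_def)
  have "coprime (int a) (int (nat n))" using assms a by simp
  then have "coprime a (nat n)" by (simp only: coprime_int_iff)
  then have "[a ^ totient (nat n) = 1] (mod nat n)" by (rule euler_theorem)
  then have "[int a ^ totient (nat n) = 1] (mod n)"
    using assms(2) by (metis cong_int_iff of_nat_1 of_nat_power int_nat_eq less_imp_le)
  moreover have "[p = int a] (mod n)" by (simp add: a cong_def)
  ultimately have "[p ^ totient (nat n) = 1] (mod n)"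
    by (meson cong_pow cong_trans)
  then show ?thesis by (simp add: cong_iff_dvd_diff)
qed

text \<open>
  The exponent \<open>T\<close> is any one with \<open>p ^ T\<close> congruent to \<open>1\<close> modulo \<open>q\<^sup>2\<close>: if \<open>p ^ m\<close> is \<open>1\<close>
  modulo \<open>q ^ K\<close> then so is \<open>(p ^ T) ^ m\<close>, and a divisor of a nonzero number is bounded by it.
\<close>

lemma power_le_exponent:
  fixes p q :: int
  assumes "q ^ 2 dvd p ^ T - 1" "p ^ T \<noteq> 1" "m \<ge> 1" "q ^ K dvd p ^ m - 1"
  shows "q ^ K \<le> \<bar>p ^ T - 1\<bar> * int m"
proof -
  have "p ^ m - 1 dvd (p ^ m) ^ T - 1" by (simp add: power_diff_1_eq)
  then have "q ^ K dvd (p ^ T) ^ m - 1"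
    using assms(4) by (metis dvd_trans power_mult mult.commute)
  then have "q ^ K dvd (p ^ T - 1) * int m"
    using power_dvd_times_exponent assms(1,3) by blast
  moreover have "(p ^ T - 1) * int m \<noteq> 0" using assms(2,3) by simp
  ultimately have "q ^ K \<le> \<bar>(p ^ T - 1) * int m\<bar>"
    by (meson dvd_imp_le_int abs_ge_self order_trans)
  then show ?thesis by (simp add: abs_mult)
qed

section \<open>Counting by the first digits\<close>

lemma cong_of_digits_eq:
  assumes "q \<ge> 2" "\<And>j. j < K \<Longrightarrow> qadic_digit q \<gamma> j = qadic_digit q \<delta> j"
  shows "q ^ K dvd \<gamma> - \<delta>"
proof (cases K)
  case (Suc k)
  define s where "s \<gamma> = (\<Sum>j\<le>k. \<gamma> div q ^ j mod q * q ^ j)" for \<gamma> :: int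
  have "q ^ K dvd \<gamma>' - s \<gamma>'" for \<gamma>'
    using is_qadic_expansion_div_mod[OF assms(1), of \<gamma>']
    unfolding is_qadic_expansion_def s_def Suc by simp
  then have "q ^ K dvd (\<gamma> - s \<gamma>) - (\<delta> - s \<delta>)" by (metis dvd_diff)
  moreover have "s \<gamma> = s \<delta>"
    unfolding s_def using assms by (intro sum.cong) (auto simp: qadic_digit_eq Suc)
  ultimately show ?thesis by simp
qed simp

lemma card_avoiding_le:
  assumes "q \<ge> 2" "b \<in> {0..q - 1}"
    and inj: "\<And>m n. m \<in> A \<Longrightarrow> n \<in> A \<Longrightarrow> q ^ K dvd f m - f n \<Longrightarrow> m = n"
    and avoid: "\<And>n j. n \<in> A \<Longrightarrow> qadic_digit q (f n) j \<noteq> b"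
  shows "card A \<le> nat (q - 1) ^ K"
proof -
  define \<phi> where "\<phi> n = restrict (qadic_digit q (f n)) {..<K}" for n
  have "card A \<le> card ({..<K} \<rightarrow>\<^sub>E {0..<q} - {b})"
  proof (rule card_inj_on_le)
    show "inj_on \<phi> A"
    proof (rule inj_onI)
      fix m n assume mn: "m \<in> A" "n \<in> A" "\<phi> m = \<phi> n"
      have "qadic_digit q (f m) j = qadic_digit q (f n) j" if "j < K" for j
        using fun_cong[OF mn(3), of j] that by (simp add: \<phi>_def)
      then show "m = n" using inj mn assms(1) cong_of_digits_eq by blast
    qed
    show "\<phi> ` A \<subseteq> {..<K} \<rightarrow>\<^sub>E {0..<q} - {b}"
    proof (intro image_subsetI PiE_I)
      fix n j assume "n \<in> A" "j \<in> {..<K}"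
      moreover have "qadic_digit q (f n) j \<in> {0..<q}" using assms(1) by (simp add: qadic_digit_eq)
      ultimately show "\<phi> n j \<in> {0..<q} - {b}" using avoid by (simp add: \<phi>_def)
    qed (simp add: \<phi>_def)
    show "finite ({..<K} \<rightarrow>\<^sub>E {0..<q} - {b})" by (simp add: finite_PiE)
  qed
  also have "\<dots> = nat (q - 1) ^ K"
    using assms(2) by (simp add: card_funcsetE card_Diff_singleton_if nat_diff_distrib')
  finally show ?thesis .
qed

text \<open>
  As \<open>\<theta> \<le> 1\<close>, the factor \<open>X \<ge> 1\<close> can be taken out of \<open>(X * Y) powr \<theta>\<close> at the price of dropping
  its exponent. The case \<open>q = 2\<close> is included: there \<open>\<theta> = 0\<close> and the left-hand side is \<open>1\<close>.
\<close>

lemma power_of_base_minus_one_le: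
  fixes q :: int and X Y :: real
  assumes "q \<ge> 2" "of_int q ^ K \<le> X * Y" "X \<ge> 1" "Y \<ge> 0"
  defines "\<theta> \<equiv> ln (of_int (q - 1)) / ln (of_int q)"
  shows "of_int (q - 1) ^ K \<le> X * Y powr \<theta>"
proof -
  have q: "ln (real_of_int q) > 0" using assms(1) by simp
  have "ln (real_of_int (q - 1)) \<le> ln (real_of_int q)" "ln (real_of_int (q - 1)) \<ge> 0"
    using assms(1) by simp_all
  with q have \<theta>: "0 \<le> \<theta>" "\<theta> \<le> 1" by (simp_all add: \<theta>_def)
  have "real_of_int q powr \<theta> = real_of_int (q - 1)"
    using assms(1) q by (simp add: powr_def \<theta>_def)
  then have "real_of_int (q - 1) ^ K = (real_of_int q powr \<theta>) powr real K"
    using assms(1) by (simp add: powr_realpow)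
  also have "\<dots> = (real_of_int q powr real K) powr \<theta>"
    by (simp add: powr_powr mult.commute)
  also have "\<dots> = (real_of_int q ^ K) powr \<theta>"
    using assms(1) by (simp add: powr_realpow)
  also have "\<dots> \<le> (X * Y) powr \<theta>" using assms \<theta> by (intro powr_mono2) auto
  also have "\<dots> = X powr \<theta> * Y powr \<theta>" by (simp add: powr_mult)
  also have "\<dots> \<le> X powr 1 * Y powr \<theta>"
    using assms(3) \<theta> by (intro mult_right_mono powr_mono) auto
  finally show ?thesis using assms(3) by simp
qed

lemma avoid_count_le:
  fixes p q b :: int
  assumes q: "q \<ge> 2" and b: "b \<in> {0..q - 1}" and p: "coprime p q"
    and T: "q ^ 2 dvd p ^ T - 1" "p ^ T \<noteq> 1" and N: "N \<ge> 1"
  shows "real (avoid_count b p q N)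
    \<le> of_int (q * \<bar>p ^ T - 1\<bar>) * real N powr (ln (of_int (q - 1)) / ln (of_int q))"
proof -
  define D where "D = \<bar>p ^ T - 1\<bar>"
  have "D \<ge> 1" using T(2) by (simp add: D_def)
  with N have "nat D * N \<ge> 1" by (simp add: Suc_le_eq)
  \<comment> \<open>\<open>q ^ K\<close> is the first power of \<open>q\<close> beyond \<open>D * N\<close>: large enough to separate the first \<open>N\<close>
    powers of \<open>p\<close>, and too large by a factor \<open>q\<close> at most.\<close>
  then obtain k where k: "nat q ^ k \<le> nat D * N" "nat D * N < nat q ^ (k + 1)"
    using ex_power_ivl1[of "nat q" "nat D * N"] q by fastforce
  define K where "K = k + 1"
  have "int (nat q ^ k) \<le> int (nat D * N)" "int (nat D * N) < int (nat q ^ (k + 1))"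
    using k by linarith+
  then have lower: "D * int N < q ^ K" and "q ^ k \<le> D * int N"
    using q \<open>D \<ge> 1\<close> by (simp_all add: K_def)
  then have upper: "q ^ K \<le> (q * D) * int N"
    using q by (simp add: K_def mult.assoc)
  define A where "A = {n. 1 \<le> n \<and> n \<le> N \<and> (\<forall>j. qadic_digit q (p ^ n) j \<noteq> b)}"
  have less: "\<not> q ^ K dvd p ^ n - p ^ m" if "m \<in> A" "n \<in> A" "m < n" for m n
  proof
    assume "q ^ K dvd p ^ n - p ^ m"
    moreover have "p ^ n - p ^ m = p ^ m * (p ^ (n - m) - 1)"
      using that(3) by (simp add: right_diff_distrib flip: power_add)
    moreover have "coprime (q ^ K) (p ^ m)" using p by (simp add: coprime_commute)
    ultimately have "q ^ K dvd p ^ (n - m) - 1"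
      by (simp add: coprime_dvd_mult_right_iff)
    then have "q ^ K \<le> D * int (n - m)"
      unfolding D_def using T that(3) by (intro power_le_exponent) auto
    also have "\<dots> \<le> D * int N"
      using that(2) \<open>D \<ge> 1\<close> by (intro mult_left_mono) (auto simp: A_def)
    finally show False using lower by simp
  qed
  have "card A \<le> nat (q - 1) ^ K"
  proof (rule card_avoiding_le[where f = "\<lambda>n. p ^ n", OF q b])
    show "m = n" if "m \<in> A" "n \<in> A" "q ^ K dvd p ^ m - p ^ n" for m n
      using less[of m n] less[of n m] that by (metis dvd_diff_commute linorder_neqE_nat)
  qed (auto simp: A_def)
  then have "real (card A) \<le> real (nat (q - 1) ^ K)" by (simp only: of_nat_le_iff)
  also have "\<dots> = of_int (q - 1) ^ K" using q by simp
  also have "\<dots> \<le> of_int (q * D) * real N powr (ln (of_int (q - 1)) / ln (of_int q))"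
  proof (rule power_of_base_minus_one_le[OF q])
    have "real_of_int (q ^ K) \<le> real_of_int (q * D * int N)"
      using upper by (simp only: of_int_le_iff)
    then show "real_of_int q ^ K \<le> real_of_int (q * D) * real N" by simp
    have "1 * 1 \<le> q * D" using q \<open>D \<ge> 1\<close> by (intro mult_mono) auto
    then show "1 \<le> real_of_int (q * D)" by (metis mult_1 of_int_1 of_int_le_iff)
  qed simp
  finally show ?thesis by (simp add: avoid_count_def A_def D_def)
qed

section \<open>A computable constant\<close>

lemma total_recursive_comp1:
  assumes "total_recursive 1 (\<lambda>xs. f (xs ! 0))" "total_recursive k g"
  shows "total_recursive k (\<lambda>xs. f (g xs))"
  using total_recursive.comp[of "[g]" "\<lambda>xs. f (xs ! 0)" k] assms by simp

lemma total_recursive_comp2: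
  assumes "total_recursive 2 (\<lambda>xs. f (xs ! 0) (xs ! 1))" "total_recursive k g" "total_recursive k h"
  shows "total_recursive k (\<lambda>xs. f (g xs) (h xs))"
  using total_recursive.comp[of "[g, h]" "\<lambda>xs. f (xs ! 0) (xs ! 1)" k] assms
  by (simp add: numeral_2_eq_2)

lemma total_recursive_const: "total_recursive k (\<lambda>xs. c)"
proof (induction c)
  case (Suc c)
  then show ?case using total_recursive_comp1[OF total_recursive.succ] by blast
qed (rule total_recursive.zero)

text \<open>
  Primitive recursion with one parameter and a step that ignores the counter, the form that
  addition, multiplication and exponentiation share.
\<close>

lemma total_recursive_iteration:
  assumes f: "total_recursive 1 (\<lambda>xs. f (xs ! 0))"
    and g: "total_recursive 2 (\<lambda>xs. g (xs ! 0) (xs ! 1))"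
    and h: "\<And>y. h 0 y = f y" "\<And>n y. h (Suc n) y = g (h n y) y"
  shows "total_recursive 2 (\<lambda>xs. h (xs ! 0) (xs ! 1))"
proof -
  have "total_recursive (1 + 2) (\<lambda>xs. g (xs ! 1) (xs ! 2))"
    by (intro total_recursive_comp2[OF g] total_recursive.proj) auto
  from total_recursive.prim_rec[OF f this]
  have "total_recursive 2 (\<lambda>xs. rec_nat (f (tl xs ! 0)) (\<lambda>n r. g r (tl xs ! 0)) (hd xs))"
    by (simp add: numeral_2_eq_2)
  moreover have "rec_nat (f y) (\<lambda>n r. g r y) n = h n y" for n y
    by (induction n) (simp_all add: h)
  ultimately show ?thesis
    by (rule_tac total_recursive.ext) (auto simp: numeral_2_eq_2 length_Suc_conv)
qed

lemma total_recursive_add: "total_recursive 2 (\<lambda>xs. xs ! 0 + xs ! 1)"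
proof (rule total_recursive_iteration[where f = "\<lambda>y. y" and g = "\<lambda>r y. Suc r"])
  show "total_recursive 2 (\<lambda>xs. Suc (xs ! 0))"
    by (intro total_recursive_comp1[OF total_recursive.succ] total_recursive.proj) simp
qed (simp_all add: total_recursive.proj)

lemma total_recursive_mult: "total_recursive 2 (\<lambda>xs. xs ! 0 * xs ! 1)"
  by (rule total_recursive_iteration[where f = "\<lambda>y. 0" and g = "\<lambda>r y. r + y"])
    (use total_recursive_add in \<open>simp_all add: total_recursive.zero\<close>)

lemma total_recursive_power: "total_recursive 2 (\<lambda>xs. (xs ! 1) ^ (xs ! 0))"
  by (rule total_recursive_iteration[where f = "\<lambda>y. 1" and g = "\<lambda>r y. r * y" and h = "\<lambda>n y. y ^ n"])
    (use total_recursive_mult total_recursive_const[of 1 1] in simp_all)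

text \<open>
  The bound is increasing in the codes, and these dominate the absolute values of \<open>p\<close> and \<open>q\<close>, so
  it can be applied to the codes directly, without computing \<open>p\<close> and \<open>q\<close> from them. The exponent
  allows for \<open>totient (q\<^sup>2) \<le> q\<^sup>2\<close> and one further factor \<open>\<bar>p\<bar> \<ge> 2\<close>, which absorbs the \<open>- 1\<close> in
  \<open>\<bar>p ^ T - 1\<bar> \<le> 2 * \<bar>p\<bar> ^ T\<close>.
\<close>

definition code_bound :: "nat \<Rightarrow> nat \<Rightarrow> nat" where
  "code_bound P Q = Q * P ^ Suc (Q * Q)"

lemma total_recursive_code_bound: "total_recursive 3 (\<lambda>xs. code_bound (xs ! 0) (xs ! 1))"
  unfolding code_bound_def
  by (intro total_recursive_comp2[OF total_recursive_mult] total_recursive.proj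
      total_recursive_comp2[OF total_recursive_power, of 3 "\<lambda>xs. Suc (xs ! 1 * xs ! 1)"]
      total_recursive_comp1[OF total_recursive.succ]) auto

lemma abs_le_int_encode: "\<bar>x\<bar> \<le> int (int_encode x)"
  by (auto simp: int_encode_def sum_encode_def)

lemma bound_le_code_bound:
  fixes p q :: int
  assumes p: "\<bar>p\<bar> \<ge> 2" and "q \<ge> 2" and T: "T \<le> nat (q ^ 2)"
  shows "q * \<bar>p ^ T - 1\<bar> \<le> int (code_bound (int_encode p) (int_encode q))"
proof -
  define P Q where "P = int_encode p" and "Q = int_encode q"
  have P: "\<bar>p\<bar> \<le> int P" and Q: "q \<le> int Q"
    using abs_le_int_encode[of p] abs_le_int_encode[of q] by (simp_all add: P_def Q_def)
  have "q ^ 2 \<le> int (Q * Q)"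
    using Q assms(2) by (simp add: power2_eq_square mult_mono)
  then have "T \<le> Q * Q" using T by linarith
  have "1 \<le> \<bar>p\<bar> ^ T" using p by simp
  then have "\<bar>p ^ T - 1\<bar> \<le> 2 * \<bar>p\<bar> ^ T"
    by (simp flip: power_abs)
  also have "\<dots> \<le> \<bar>p\<bar> ^ Suc T" using p by (simp add: mult_right_mono)
  also have "\<dots> \<le> int P ^ Suc T" using P by (intro power_mono) auto
  also have "\<dots> \<le> int P ^ Suc (Q * Q)"
    using P p \<open>T \<le> Q * Q\<close> by (intro power_increasing) auto
  finally have "q * \<bar>p ^ T - 1\<bar> \<le> int Q * int P ^ Suc (Q * Q)"
    using Q assms(2) by (intro mult_mono) auto
  then show ?thesis by (simp add: code_bound_def P_def Q_def)
qed

theorem corollary1p9: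
  "\<exists>C :: int \<Rightarrow> int \<Rightarrow> int \<Rightarrow> nat. computable_int3 C \<and>
     (\<forall>p q b :: int.
        coprime p q \<and> q \<ge> 2 \<and> p \<noteq> 1 \<and> p \<noteq> - 1 \<and> b \<in> {0..q - 1} \<longrightarrow>
        (\<forall>N :: nat. N \<ge> 1 \<longrightarrow>
           real (avoid_count b p q N)
             \<le> real (C p q b) * real N powr (ln (real_of_int (q - 1)) / ln (real_of_int q))))"
proof (intro exI conjI allI impI)
  let ?C = "\<lambda>p q b :: int. code_bound (int_encode p) (int_encode q)"
  show "computable_int3 ?C"
    unfolding computable_int3_def using total_recursive_code_bound
    by (intro exI[of _ "\<lambda>xs. code_bound (xs ! 0) (xs ! 1)"]) simp
  fix p q b :: int and N :: nat
  assume asm: "coprime p q \<and> q \<ge> 2 \<and> p \<noteq> 1 \<and> p \<noteq> - 1 \<and> b \<in> {0..q - 1}" and N: "N \<ge> 1"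
  then have q: "q \<ge> 2" by simp
  \<comment> \<open>\<open>p = 0\<close> is excluded because \<open>0\<close> is coprime to units only.\<close>
  have "p \<noteq> 0" using asm by auto
  with asm have p: "\<bar>p\<bar> \<ge> 2" by linarith
  define T where "T = totient (nat (q ^ 2))"
  have T: "q ^ 2 dvd p ^ T - 1"
    unfolding T_def using asm by (intro euler_theorem_int) auto
  have "T > 0" using q by (simp add: T_def)
  then have "\<bar>p\<bar> ^ T > 1" using p by (intro one_less_power) auto
  then have "p ^ T \<noteq> 1" by (metis abs_1 less_irrefl power_abs)
  with T N asm have "real (avoid_count b p q N)
      \<le> of_int (q * \<bar>p ^ T - 1\<bar>) * real N powr (ln (of_int (q - 1)) / ln (of_int q))"
    by (intro avoid_count_le) auto
  also have "\<dots> \<le> real (?C p q b) * real N powr (ln (of_int (q - 1)) / ln (of_int q))"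
  proof (rule mult_right_mono)
    have "q * \<bar>p ^ T - 1\<bar> \<le> int (?C p q b)"
      using p q by (intro bound_le_code_bound) (simp_all add: T_def totient_le)
    then show "real_of_int (q * \<bar>p ^ T - 1\<bar>) \<le> real (?C p q b)"
      by (metis of_int_le_iff of_int_of_nat_eq)
  qed simp
  finally show "real (avoid_count b p q N)
      \<le> real (?C p q b) * real N powr (ln (real_of_int (q - 1)) / ln (real_of_int q))" .
qed

end
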